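(* For any natural numbers $k$ and $d$ there is a graph $G$ such that the interval spectrum $S(G)$ has exactly $k$ gaps, each of size at least $d$.
   Context: All graphs are finite. A graph $G=(V,E)$ is interval colorable if there is an edge-coloring $c\colon E\to\mathbb{Z}$ such that for every vertex $x$ the multiset $\{c(xy): xy\in E\}$ is a set of consecutive integers. For such $c$ let $c(G)=\{c(e):e\in E\}$. $G$ is $t$-interval colorable if it has an interval coloring $c$ with $|c(G)|=t$. The interval spectrum $S(G)$ is the set of all integers $t$ such that $G$ is $t$-interval colorable. A gap of a set of integers $S$ is a maximal non-empty set $X$ of consecutive integers with $X\cap S=\emptyset$, $\min S<\min X$ and $\max S>\max X$; its size is $|X|$. *)

theory Defs
  imports Main "HOL-Library.Multiset"
begin

definition fin_graph :: "'a set \<Rightarrow> 'a set set \<Rightarrow> bool" where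
  "fin_graph V E \<longleftrightarrow> finite V \<and> (\<forall>e\<in>E. e \<subseteq> V \<and> card e = 2)"

text \<open>The empty set counts as a set of consecutive integers, so isolated vertices
  impose no condition on a coloring.\<close>

definition consecutive :: "int set \<Rightarrow> bool" where
  "consecutive X \<longleftrightarrow> (\<exists>a b. X = {a..b})"

text \<open>The equation of multisets forces the edges at a vertex to receive pairwise
  distinct colors.\<close>

definition interval_coloring :: "'a set \<Rightarrow> 'a set set \<Rightarrow> ('a set \<Rightarrow> int) \<Rightarrow> bool" where
  "interval_coloring V E c \<longleftrightarrow>
     (\<forall>x\<in>V. \<exists>X. consecutive X \<and> image_mset c (mset_set {e \<in> E. x \<in> e}) = mset_set X)"

definition t_interval_colorable :: "'a set \<Rightarrow> 'a set set \<Rightarrow> int \<Rightarrow> bool" where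
  "t_interval_colorable V E t \<longleftrightarrow>
     (\<exists>c. interval_coloring V E c \<and> int (card (c ` E)) = t)"

definition interval_spectrum :: "'a set \<Rightarrow> 'a set set \<Rightarrow> int set" where
  "interval_spectrum V E = {t. t_interval_colorable V E t}"

definition gap_candidate :: "int set \<Rightarrow> int set \<Rightarrow> bool" where
  "gap_candidate S X \<longleftrightarrow>
     X \<noteq> {} \<and> consecutive X \<and> X \<inter> S = {} \<and> Min S < Min X \<and> Max S > Max X"

text \<open>Gaps are only considered for finite non-empty sets, where the minimum and maximum are
  meaningful; the spectrum of a finite graph is always finite.\<close>

definition gaps :: "int set \<Rightarrow> int set set" where
  "gaps S = {X. finite S \<and> S \<noteq> {} \<and> gap_candidate S X \<and>
                (\<forall>Y. gap_candidate S Y \<and> X \<subseteq> Y \<longrightarrow> Y = X)}"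

lemma finite_edges: "fin_graph V E \<Longrightarrow> finite E"
  unfolding fin_graph_def by (meson Pow_iff finite_Pow_iff finite_subset subsetI)

lemma finite_interval_spectrum:
  assumes "fin_graph V E"
  shows "finite (interval_spectrum V E)"
proof (rule finite_subset)
  show "interval_spectrum V E \<subseteq> int ` {..card E}"
    using card_image_le[OF finite_edges[OF assms]]
    by (auto simp: interval_spectrum_def t_interval_colorable_def)
qed simp

end

theory Submission
  imports Defs "HOL-Library.Countable"
begin

text \<open>
  Delete an edge \<open>uw\<close> from \<open>K\<^bsub>p,q\<^esub>\<close> and hang a pendant edge on each of \<open>u\<close> and \<open>w\<close>. In an interval
  colouring, summing all colours once over the left and once over the right vertices shows that the
  two pendant colours agree modulo \<open>n\<close> if \<open>(p,q)\<close> is \<open>(n,n)\<close> or \<open>(n,2n)\<close>; they differ by at most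
  \<open>p + q\<close>, and if they differ by exactly \<open>p + q\<close>, then the colours used are precisely those between them.

  A gadget consists of such a \<open>K\<^bsub>n,2n\<^esub>\<close> and such a \<open>K\<^bsub>n',n'\<^esub>\<close> that share one pendant edge and whose
  other pendant edges meet in a hub. The displacements \<open>i n\<close> and \<open>i' n'\<close> of the two parts
  (\<open>\<bar>i\<bar> \<le> 3\<close>, \<open>\<bar>i'\<bar> \<le> 2\<close>) differ by less than the hub degree but are not equal, since the hub edges have
  distinct colours. With \<open>n = 2s + 1\<close>, \<open>n' = 3s + 2 - g\<close> and \<open>s\<close> large this forces
  \<open>(i, i') = \<plusminus>(3, 2)\<close>: the gadget extends rigidly upwards or downwards from the hub by about \<open>6s\<close>.
  Joining gadgets \<open>g = 1, \<dots>, k + 1\<close> with \<open>s = g S\<close> at one hub, the number of colours is determined by the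
  largest gadget together with the largest one pointing the opposite way, if there is any. So the
  spectrum has exactly \<open>k + 1\<close> elements, with distances of about \<open>6S\<close>.
\<close>

subsection \<open>Functions with consecutive values\<close>

definition consec_on :: "('b \<Rightarrow> int) \<Rightarrow> 'b set \<Rightarrow> bool" where
  "consec_on f I \<longleftrightarrow> inj_on f I \<and> (\<exists>a b. f ` I = {a..b})"

lemma consec_on_image:
  assumes "consec_on f I" "I \<noteq> {}"
  obtains a where "f ` I = {a..a + int (card I) - 1}"
proof -
  obtain a b where ab: "f ` I = {a..b}" and inj: "inj_on f I"
    using assms(1) by (auto simp: consec_on_def)
  have "card I = card {a..b}"
    using card_image[OF inj] ab by simp
  moreover have "a \<le> b"
    using ab assms(2) by (metis atLeastatMost_empty_iff image_is_empty)
  ultimately have "b = a + int (card I) - 1" by simp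
  with ab that show thesis by blast
qed

lemma consec_on_uminus:
  assumes "consec_on f I"
  shows "consec_on (\<lambda>x. - f x) I"
proof -
  obtain a b where ab: "f ` I = {a..b}" and inj: "inj_on f I"
    using assms by (auto simp: consec_on_def)
  have "(\<lambda>x. - f x) ` I = uminus ` (f ` I)" by (simp add: image_image)
  also have "\<dots> = {-b..-a}" using ab by simp
  finally show ?thesis using inj by (auto simp: consec_on_def inj_on_def)
qed

lemma consec_on_less_card:
  assumes "consec_on f I" "x \<in> I" "y \<in> I"
  shows "f x - f y < int (card I)"
proof -
  obtain a where a: "f ` I = {a..a + int (card I) - 1}"
    using consec_on_image assms by (metis empty_iff)
  then have "f x \<in> {a..a + int (card I) - 1}" "f y \<in> {a..a + int (card I) - 1}"
    using assms by blast+
  then show ?thesis by auto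
qed

text \<open>An arithmetic series with difference 1; doubling avoids the half in its sum.\<close>

lemma consec_on_sum:
  assumes "consec_on f I" "finite I"
  shows "\<exists>a. 2 * sum f I = 2 * int (card I) * a + int (card I) * (int (card I) - 1)"
proof (cases "I = {}")
  case False
  then obtain a where a: "f ` I = {a..a + int (card I) - 1}"
    using consec_on_image assms(1) by metis
  have inj: "inj_on f I" using assms by (simp add: consec_on_def)
  have *: "2 * (\<Sum>x\<in>{a..a + int n - 1}. x) = 2 * int n * a + int n * (int n - 1)" for n
  proof (induction n)
    case (Suc n)
    have "{a..a + int (Suc n) - 1} = insert (a + int n) {a..a + int n - 1}" by auto
    then show ?case using Suc by (simp add: algebra_simps)
  qed simp
  have "sum f I = (\<Sum>x\<in>f ` I. x)" using inj by (simp add: sum.reindex)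
  then show ?thesis using a * by metis
qed simp

lemma consec_on_shift:
  fixes a :: int
  assumes "\<And>j. j < n \<Longrightarrow> f j = a + int j"
  shows "consec_on f {..<n::nat}"
proof -
  have "f ` {..<n} = {a..a + int n - 1}"
  proof (intro equalityI subsetI)
    fix x assume "x \<in> {a..a + int n - 1}"
    then have "x = f (nat (x - a))" "nat (x - a) < n" using assms by auto
    then show "x \<in> f ` {..<n}" by blast
  qed (use assms in auto)
  then show ?thesis using assms by (auto simp: consec_on_def inj_on_def)
qed

text \<open>Index 0 takes the top value instead of the bottom one. In the explicit grid below this
  is the shape of column 0 and of all rows except row 0.\<close>

lemma consec_on_cyclic:
  fixes a :: int
  assumes "\<And>j. 0 < j \<Longrightarrow> j < n \<Longrightarrow> f j = a + int j" "f 0 = a + int n" "0 < n"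
  shows "consec_on f {..<n::nat}"
proof -
  have "f ` {..<n} = {a + 1..a + int n}"
  proof (intro equalityI subsetI)
    fix x assume x: "x \<in> {a + 1..a + int n}"
    show "x \<in> f ` {..<n}"
    proof (cases "x = a + int n")
      case False
      then have "x = f (nat (x - a))" "nat (x - a) < n" using assms x by auto
      then show ?thesis by blast
    qed (use assms in force)
  next
    fix x assume "x \<in> f ` {..<n}"
    then obtain j where "j < n" "x = f j" by blast
    then show "x \<in> {a + 1..a + int n}" using assms by (cases "j = 0") auto
  qed
  moreover have "inj_on f {..<n}"
  proof (rule inj_onI)
    fix x y assume "x \<in> {..<n}" "y \<in> {..<n}" "f x = f y"
    then show "x = y" using assms by (cases "x = 0"; cases "y = 0") auto
  qed
  ultimately show ?thesis by (auto simp: consec_on_def)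
qed

subsection \<open>Complete bipartite graphs with two ports\<close>

text \<open>\<open>R i j\<close> and \<open>C i j\<close> are the colours of the edge \<open>u\<^sub>i w\<^sub>j\<close> as seen from \<open>u\<^sub>i\<close> and \<open>w\<^sub>j\<close>. The edge
  \<open>u\<^sub>0 w\<^sub>0\<close> is absent: its places hold the colours of the pendant edges at \<open>u\<^sub>0\<close> and \<open>w\<^sub>0\<close>.\<close>

locale ported_grid =
  fixes p q :: nat and R C :: "nat \<Rightarrow> nat \<Rightarrow> int"
  assumes p2: "2 \<le> p" and q2: "2 \<le> q"
    and rows: "\<And>i. i < p \<Longrightarrow> consec_on (R i) {..<q}"
    and cols: "\<And>j. j < q \<Longrightarrow> consec_on (\<lambda>i. C i j) {..<p}"
    and agree: "\<And>i j. i < p \<Longrightarrow> j < q \<Longrightarrow> (i, j) \<noteq> (0, 0) \<Longrightarrow> R i j = C i j"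
begin

lemma ported_grid_uminus: "ported_grid p q (\<lambda>i j. - R i j) (\<lambda>i j. - C i j)"
  using p2 q2 by unfold_locales (auto intro: consec_on_uminus rows cols simp: agree)

text \<open>Double counting: the total over the rows and the total over the columns differ only at
  the place (0,0). The last summand collects the triangular terms of the two totals.\<close>

lemma port_difference:
  "\<exists>A B. 2 * (R 0 0 - C 0 0) = 2 * int q * A - 2 * int p * B + int p * int q * (int q - int p)"
proof -
  have "\<exists>a. \<forall>i<p. 2 * sum (R i) {..<q} = 2 * int q * a i + int q * (int q - 1)"
    using consec_on_sum[OF rows] by (intro choice) (metis card_lessThan finite_lessThan)
  then obtain a where a: "\<And>i. i < p \<Longrightarrow> 2 * sum (R i) {..<q} = 2 * int q * a i + int q * (int q - 1)"
    by blast
  have "\<exists>b. \<forall>j<q. 2 * (\<Sum>i<p. C i j) = 2 * int p * b j + int p * (int p - 1)"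
    using consec_on_sum[OF cols] by (intro choice) (metis card_lessThan finite_lessThan)
  then obtain b where b: "\<And>j. j < q \<Longrightarrow> 2 * (\<Sum>i<p. C i j) = 2 * int p * b j + int p * (int p - 1)"
    by blast
  have "2 * (\<Sum>i<p. \<Sum>j<q. R i j) = (\<Sum>i<p. 2 * sum (R i) {..<q})" by (simp add: sum_distrib_left)
  also have "\<dots> = (\<Sum>i<p. 2 * int q * a i + int q * (int q - 1))" using a by (intro sum.cong) auto
  also have "\<dots> = 2 * int q * (\<Sum>i<p. a i) + int p * (int q * (int q - 1))"
    by (simp add: sum.distrib sum_distrib_left)
  finally have sR: "2 * (\<Sum>i<p. \<Sum>j<q. R i j) = 2 * int q * (\<Sum>i<p. a i) + int p * (int q * (int q - 1))" .
  have "2 * (\<Sum>i<p. \<Sum>j<q. C i j) = 2 * (\<Sum>j<q. \<Sum>i<p. C i j)" by (subst sum.swap) simp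
  also have "\<dots> = (\<Sum>j<q. 2 * (\<Sum>i<p. C i j))" by (simp add: sum_distrib_left)
  also have "\<dots> = (\<Sum>j<q. 2 * int p * b j + int p * (int p - 1))" using b by (intro sum.cong) auto
  also have "\<dots> = 2 * int p * (\<Sum>j<q. b j) + int q * (int p * (int p - 1))"
    by (simp add: sum.distrib sum_distrib_left)
  finally have sC: "2 * (\<Sum>i<p. \<Sum>j<q. C i j) = 2 * int p * (\<Sum>j<q. b j) + int q * (int p * (int p - 1))" .
  have "(\<Sum>i<p. \<Sum>j<q. R i j) - (\<Sum>i<p. \<Sum>j<q. C i j) = (\<Sum>i<p. \<Sum>j<q. R i j - C i j)"
    by (simp add: sum_subtractf)
  also have "\<dots> = (\<Sum>i<p. \<Sum>j<q. if (i, j) = (0, 0) then R 0 0 - C 0 0 else 0)"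
    using agree by (intro sum.cong) auto
  also have "\<dots> = (\<Sum>i<p. if i = 0 then R 0 0 - C 0 0 else 0)"
    using q2 by (intro sum.cong) auto
  also have "\<dots> = R 0 0 - C 0 0" using p2 by simp
  finally have "2 * (R 0 0 - C 0 0) = 2 * int q * (\<Sum>i<p. a i) - 2 * int p * (\<Sum>j<q. b j)
      + int p * int q * (int q - int p)"
    using sR sC by (simp add: algebra_simps)
  then show ?thesis by blast
qed

text \<open>An inner entry shares its row with an entry of column 0 and its column with an entry of
  row 0. Together the estimates show that \<open>C i 0\<close> exceeds \<open>R 0 j\<close> by at
  most p + q - 2.\<close>

lemma entry_bounds:
  assumes "0 < i" "i < p" "0 < j" "j < q"
  shows "C i 0 - int q < C i j" "C i j < R 0 j + int p"
proof -
  have "R i 0 - R i j < int q"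
    using consec_on_less_card[OF rows, of i 0 j] assms by simp
  then show "C i 0 - int q < C i j" using agree[of i 0] agree[of i j] assms by simp
  have "C i j - C 0 j < int p"
    using consec_on_less_card[OF cols, of j i 0] assms by simp
  then show "C i j < R 0 j + int p" using agree[of 0 j] assms by simp
qed

text \<open>If \<open>R 0 0\<close> is the minimum of row 0, the next value is taken, otherwise the
  minimum itself. The last conclusion identifies \<open>R 0 0\<close> as the minimum once
  \<open>R 0 j\<close> is known to be larger.\<close>

lemma row_near_port:
  obtains j where "0 < j" "j < q" "R 0 j \<le> R 0 0 + 1"
    and "(\<exists>j'<q. R 0 j' < R 0 0) \<longrightarrow> R 0 j < R 0 0"
proof -
  obtain a where a: "R 0 ` {..<q} = {a..a + int q - 1}"
    using consec_on_image[OF rows, of 0] p2 q2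
    by (metis card_lessThan empty_iff gr0I lessThan_iff not_numeral_le_zero)
  have mem: "R 0 j \<in> {a..a + int q - 1}" if "j < q" for j using a that by blast
  show thesis
  proof (cases "R 0 0 = a")
    case True
    have "a + 1 \<in> R 0 ` {..<q}" using a q2 by simp
    then obtain j where j: "j < q" "R 0 j = a + 1" by auto
    then have "0 < j" using True by (cases j) auto
    moreover have "\<not> (\<exists>j'<q. R 0 j' < R 0 0)" using mem True by (metis atLeastAtMost_iff not_le)
    ultimately show thesis using j True by (intro that[of j]) auto
  next
    case False
    have "a \<in> R 0 ` {..<q}" using a q2 by simp
    then obtain j where j: "j < q" "R 0 j = a" by auto
    then have "0 < j" using False by (cases j) auto
    moreover have "a < R 0 0" using mem[of 0] False q2 by auto
    ultimately show thesis using j by (intro that[of j]) auto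
  qed
qed

lemma col_near_port:
  obtains i where "0 < i" "i < p" "C i 0 \<ge> C 0 0 - 1"
    and "(\<exists>i'<p. C i' 0 > C 0 0) \<longrightarrow> C i 0 > C 0 0"
proof -
  \<comment> \<open>Transposing and negating exchanges the two ports, so the choice in row 0 becomes
    the choice in column 0.\<close>
  interpret T: ported_grid q p "\<lambda>i j. - C j i" "\<lambda>i j. - R j i"
    using p2 q2 by unfold_locales (auto intro: consec_on_uminus rows cols simp: agree)
  obtain i where "0 < i" "i < p" "- C i 0 \<le> - C 0 0 + 1"
    "(\<exists>i'<p. - C i' 0 < - C 0 0) \<longrightarrow> - C i 0 < - C 0 0" by (rule T.row_near_port)
  then show thesis by (intro that[of i]) auto
qed

lemma port_bound: "C 0 0 - R 0 0 \<le> int p + int q"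
proof -
  obtain j where j: "0 < j" "j < q" "R 0 j \<le> R 0 0 + 1" using row_near_port by blast
  obtain i where i: "0 < i" "i < p" "C i 0 \<ge> C 0 0 - 1" using col_near_port by blast
  show ?thesis using entry_bounds[OF i(1,2) j(1,2)] i j by linarith
qed

text \<open>Equality in \<open>port_bound\<close> turns the estimates behind it into equalities.
  This fixes one entry next to each port and makes the ports the extremes of row 0 and column
  0.\<close>

lemma tight_grid:
  assumes tight: "C 0 0 = R 0 0 + int p + int q"
  shows "\<And>i j. i < p \<Longrightarrow> j < q \<Longrightarrow> R i j \<in> {R 0 0..C 0 0}"
    and "p \<le> q \<Longrightarrow> {R 0 0..C 0 0} \<subseteq> {x. \<exists>i<p. \<exists>j<q. x = R i j \<or> x = C i j}"
proof -
  obtain j where j: "0 < j" "j < q" "R 0 j \<le> R 0 0 + 1"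
    and jmin: "(\<exists>j'<q. R 0 j' < R 0 0) \<longrightarrow> R 0 j < R 0 0" using row_near_port by blast
  obtain i where i: "0 < i" "i < p" "C i 0 \<ge> C 0 0 - 1"
    and imax: "(\<exists>i'<p. C i' 0 > C 0 0) \<longrightarrow> C i 0 > C 0 0" using col_near_port by blast
  have eq: "R 0 j = R 0 0 + 1" "C i 0 = C 0 0 - 1"
    using entry_bounds[OF i(1,2) j(1,2)] i j tight by linarith+
  have lo0: "R 0 0 \<le> R 0 j'" if "j' < q" for j' using jmin eq that by force
  have hi0: "C i' 0 \<le> C 0 0" if "i' < p" for i' using imax eq that by force
  \<comment> \<open>Column \<open>j\<close> caps \<open>R i' j\<close> at \<open>R 0 0 + p\<close>;
    moving along row \<open>i'\<close> adds at most q - 1.\<close>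
  have hi: "C i' 0 \<le> C 0 0 \<and> (\<forall>j'<q. 0 < i' \<longrightarrow> R i' j' < C 0 0)" if "i' < p" for i'
  proof (intro conjI allI impI)
    fix j' assume j': "j' < q" and i': "0 < i'"
    have "C i' j < R 0 j + int p" using entry_bounds(2) i' that j by blast
    moreover have "R i' j' - R i' j < int q"
      using consec_on_less_card[OF rows[OF that], of j' j] j' j by simp
    ultimately show "R i' j' < C 0 0" using agree[OF that, of j] i' j eq tight by force
  qed (use hi0 that in auto)
  have hi00: "R 0 j' < C 0 0" if "j' < q" for j'
    using consec_on_less_card[OF rows, of 0 j' 0] that p2 tight by simp
  \<comment> \<open>Dually, row \<open>i\<close> keeps \<open>C i j'\<close> at
    \<open>R 0 0 + p\<close> or above, and moving along column \<open>j'\<close> loses at most p -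
    1.\<close>
  have lo: "R 0 0 < C i' j'" if "i' < p" "j' < q" "0 < j'" for i' j'
  proof -
    have "C i 0 - int q < C i j'" using entry_bounds(1) i that by blast
    moreover have "C i j' - C i' j' < int p"
      using consec_on_less_card[OF cols[OF that(2)], of i i'] that i by simp
    ultimately show ?thesis using eq tight by linarith
  qed
  have lo00: "R 0 0 < C i' 0" if "i' < p" for i'
    using consec_on_less_card[OF cols, of 0 0 i'] that q2 tight by simp
  show "R i' j' \<in> {R 0 0..C 0 0}" if "i' < p" "j' < q" for i' j'
  proof (cases "(i', j') = (0, 0)")
    case True
    then show ?thesis using hi00[of 0] that by auto
  next
    case False
    have "R i' j' \<le> C 0 0" using hi[OF that(1)] hi00 that by (cases "i' = 0") (auto intro: less_imp_le)
    moreover have "R 0 0 \<le> C i' j'"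
      using lo[OF that] lo00[OF that(1)] by (cases "j' = 0") (auto intro: less_imp_le)
    ultimately show ?thesis using agree[OF that] False by simp
  qed
  show "{R 0 0..C 0 0} \<subseteq> {x. \<exists>i<p. \<exists>j<q. x = R i j \<or> x = C i j}" if pq: "p \<le> q"
  proof
    fix x assume x: "x \<in> {R 0 0..C 0 0}"
    have ne: "{..<p} \<noteq> {}" "{..<q} \<noteq> {}" using p2 q2 by (simp_all add: lessThan_empty_iff)
    obtain a where a: "R 0 ` {..<q} = {a..a + int q - 1}"
      using consec_on_image[OF rows ne(2), of 0] p2 by auto
    have "a = R 0 0"
    proof -
      have "a \<in> R 0 ` {..<q}" using a q2 by simp
      then have "R 0 0 \<le> a" using lo0 by auto
      moreover have "R 0 0 \<in> {a..a + int q - 1}" unfolding a[symmetric] using q2 by simp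
      ultimately show ?thesis by simp
    qed
    obtain b where b: "(\<lambda>i. C i 0) ` {..<p} = {b..b + int p - 1}"
      using consec_on_image[OF cols ne(1), of 0] q2 by auto
    have "b + int p - 1 = C 0 0"
    proof -
      have "b + int p - 1 \<in> (\<lambda>i. C i 0) ` {..<p}" using b p2 by simp
      then have "b + int p - 1 \<le> C 0 0" using hi0 by auto
      moreover have "C 0 0 \<in> {b..b + int p - 1}" unfolding b[symmetric] using p2 by simp
      ultimately show ?thesis by simp
    qed
    obtain e where e: "R i ` {..<q} = {e..e + int q - 1}"
      using consec_on_image[OF rows ne(2), of i] i by auto
    have "e + int q - 1 = C 0 0 - 1"
    proof -
      have "e + int q - 1 \<in> R i ` {..<q}" using e q2 by simp
      then have "e + int q - 1 < C 0 0" using hi[OF i(2)] i by auto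
      moreover have "C 0 0 - 1 \<in> R i ` {..<q}"
        using eq agree[of i 0] i q2 by (intro image_eqI[of _ _ 0]) auto
      ultimately show ?thesis using e by auto
    qed
    \<comment> \<open>Row 0 covers the \<open>q\<close> lowest colours, row \<open>i\<close> those
      from \<open>R 0 0 + p\<close> to \<open>C 0 0 - 1\<close>, and column 0 supplies
      \<open>C 0 0\<close>. By \<open>p \<le> q\<close> nothing is left out between the two
      rows.\<close>
    consider "x \<in> {a..a + int q - 1}" | "x \<in> {b..b + int p - 1}" | "x \<in> {e..e + int q - 1}"
      using x \<open>a = R 0 0\<close> \<open>b + int p - 1 = C 0 0\<close> \<open>e + int q - 1 = C 0 0 - 1\<close> tight pq p2
      by (cases "x \<le> R 0 0 + int q - 1"; cases "x = C 0 0") auto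
    then show "x \<in> {x. \<exists>i<p. \<exists>j<q. x = R i j \<or> x = C i j}"
    proof cases
      case 1
      then have "x \<in> R 0 ` {..<q}" using a by simp
      then show ?thesis using p2 by force
    next
      case 2
      then have "x \<in> (\<lambda>i. C i 0) ` {..<p}" using b by simp
      then show ?thesis using q2 by force
    next
      case 3
      then have "x \<in> R i ` {..<q}" using e by simp
      then show ?thesis using i by force
    qed
  qed
qed

end

subsection \<open>Colourings, spectra and gaps\<close>

text \<open>Replaces the multiset condition at a vertex by \<open>consec_on\<close> along an
  injective indexing \<open>F\<close> of its edges. Equal sizes of the two multisets yield
  injectivity of the colours.\<close>

lemma consecutive_mset_iff:
  assumes "finite I" "inj_on F I" "D = F ` I"
  shows "(\<exists>X. consecutive X \<and> image_mset c (mset_set D) = mset_set X) \<longleftrightarrow> consec_on (\<lambda>x. c (F x)) I"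
proof -
  have eq: "image_mset c (mset_set D) = image_mset (\<lambda>x. c (F x)) (mset_set I)"
    using assms by (simp add: image_mset_mset_set[symmetric] multiset.map_comp comp_def)
  show ?thesis
  proof
    assume "\<exists>X. consecutive X \<and> image_mset c (mset_set D) = mset_set X"
    then obtain a b where ab: "image_mset (\<lambda>x. c (F x)) (mset_set I) = mset_set {a..b}"
      unfolding eq consecutive_def by blast
    have im: "(\<lambda>x. c (F x)) ` I = {a..b}"
      using arg_cong[OF ab, of set_mset] assms(1) by simp
    have "card I = card {a..b}" using arg_cong[OF ab, of size] by simp
    then have "inj_on (\<lambda>x. c (F x)) I" using im assms(1) by (intro eq_card_imp_inj_on) auto
    with im show "consec_on (\<lambda>x. c (F x)) I" by (auto simp: consec_on_def)
  next
    assume "consec_on (\<lambda>x. c (F x)) I"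
    then show "\<exists>X. consecutive X \<and> image_mset c (mset_set D) = mset_set X"
      unfolding eq consec_on_def consecutive_def by (metis image_mset_mset_set)
  qed
qed

lemma interval_coloring_image:
  assumes "inj h"
  shows "interval_coloring (h ` V) ((`) h ` E) c \<longleftrightarrow> interval_coloring V E (\<lambda>e. c (h ` e))"
proof -
  have inj: "inj_on ((`) h) A" for A using assms by (simp add: inj_on_def inj_image_eq_iff)
  have inc: "{e \<in> (`) h ` E. h x \<in> e} = (`) h ` {e \<in> E. x \<in> e}" for x
    using inj_image_mem_iff[OF assms] by blast
  have "image_mset c (mset_set {e \<in> (`) h ` E. h x \<in> e}) =
      image_mset (\<lambda>e. c (h ` e)) (mset_set {e \<in> E. x \<in> e})" for x
    unfolding inc by (simp add: image_mset_mset_set[OF inj, symmetric] multiset.map_comp comp_def)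
  then show ?thesis by (simp add: interval_coloring_def)
qed

text \<open>Serves to move the construction from \<open>vert\<close> to natural numbers.\<close>

lemma interval_spectrum_image:
  assumes "inj h"
  shows "interval_spectrum (h ` V) ((`) h ` E) = interval_spectrum V E"
proof -
  have "(\<exists>c. interval_coloring (h ` V) ((`) h ` E) c \<and> int (card (c ` (`) h ` E)) = t) \<longleftrightarrow>
      (\<exists>c. interval_coloring V E c \<and> int (card (c ` E)) = t)" (is "?l \<longleftrightarrow> ?r") for t
  proof
    assume ?l
    then show ?r unfolding interval_coloring_image[OF assms] image_image by blast
  next
    assume ?r
    then obtain c where c: "interval_coloring V E c" "int (card (c ` E)) = t" by blast
    have "(\<lambda>e. c (h -` (h ` e))) = c" using assms by (simp add: inj_vimage_image_eq)
    then have "interval_coloring (h ` V) ((`) h ` E) (\<lambda>e. c (h -` e))"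
      "int (card ((\<lambda>e. c (h -` e)) ` (`) h ` E)) = t"
      using c unfolding interval_coloring_image[OF assms] image_image by metis+
    then show ?l by blast
  qed
  then show ?thesis by (simp add: interval_spectrum_def t_interval_colorable_def)
qed

lemma fin_graph_image:
  assumes "inj h" "fin_graph V E"
  shows "fin_graph (h ` V) ((`) h ` E)"
  using assms by (auto simp: fin_graph_def card_image inj_on_subset)

text \<open>Successive values are at least 2 apart, so every open interval between them contains an
  integer and is a maximal candidate.\<close>

lemma gaps_sparse:
  fixes v :: "nat \<Rightarrow> int"
  assumes step: "\<And>i. i < k \<Longrightarrow> v i + 1 < v (Suc i)"
  shows "gaps (v ` {..k}) = (\<lambda>i. {v i + 1..v (Suc i) - 1}) ` {..<k}"
    and "inj_on (\<lambda>i. {v i + 1..v (Suc i) - 1}) {..<k}"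
proof -
  define G where "G i = {v i + 1..v (Suc i) - 1}" for i
  have mono: "v i \<le> v j" if "i \<le> j" "j \<le> k" for i j
    using that
  proof (induction j rule: dec_induct)
    case (step j)
    then show ?case using assms[of j] by simp
  qed simp
  have Min: "Min (v ` {..k}) = v 0" by (rule Min_eqI) (use mono in auto)
  have Max: "Max (v ` {..k}) = v k" by (rule Max_eqI) (use mono in auto)
  have cand: "gap_candidate (v ` {..k}) X \<longleftrightarrow>
      (\<exists>a b. X = {a..b} \<and> a \<le> b \<and> v 0 < a \<and> b < v k \<and> (\<forall>i\<le>k. v i \<notin> {a..b}))" (is "?l \<longleftrightarrow> ?r") for X
  proof
    assume ?l
    then obtain a b where ab: "X = {a..b}" "X \<noteq> {}" "X \<inter> v ` {..k} = {}" "v 0 < Min X" "Max X < v k"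
      by (auto simp: gap_candidate_def consecutive_def Min Max)
    then have "a \<le> b" by simp
    then have "Min X = a" "Max X = b" using ab(1) by (auto intro: Min_eqI Max_eqI)
    with ab \<open>a \<le> b\<close> show ?r by auto
  next
    assume ?r
    then obtain a b where ab: "X = {a..b}" "a \<le> b" "v 0 < a" "b < v k" "\<forall>i\<le>k. v i \<notin> {a..b}" by blast
    then have "Min X = a" "Max X = b" by (auto intro: Min_eqI Max_eqI)
    with ab show ?l by (auto simp: gap_candidate_def consecutive_def Min Max)
  qed
  have inside: "\<exists>i<k. X \<subseteq> G i" if X: "gap_candidate (v ` {..k}) X" for X
  proof -
    obtain a b where ab: "X = {a..b}" "a \<le> b" "v 0 < a" "b < v k" "\<forall>i\<le>k. v i \<notin> {a..b}"
      using X cand by blast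
    \<comment> \<open>The first value at or above \<open>a\<close> is \<open>v (Suc i)\<close>;
      since \<open>X\<close> misses all values, it lies above \<open>b\<close> too.\<close>
    define i where "i = (LEAST i. a \<le> v (Suc i))"
    have "0 < k" using ab by (cases k) auto
    then obtain k' where k': "k = Suc k'" by (cases k) auto
    have ex: "a \<le> v (Suc k')" using ab k' by simp
    have i: "a \<le> v (Suc i)" unfolding i_def by (rule LeastI) (rule ex)
    have "i \<le> k'" unfolding i_def by (rule Least_le) (rule ex)
    then have "i < k" using k' by simp
    have "v i < a"
    proof (cases i)
      case (Suc i')
      then show ?thesis using not_less_Least[of i' "\<lambda>i. a \<le> v (Suc i)"] i_def by force
    qed (use ab in simp)
    moreover have "b < v (Suc i)" using ab(5) \<open>i < k\<close> i by (meson atLeastAtMost_iff not_le Suc_leI)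
    ultimately show ?thesis using ab \<open>i < k\<close> by (auto simp: G_def)
  qed
  have candG: "gap_candidate (v ` {..k}) (G i)" if "i < k" for i
    unfolding cand G_def
  proof (intro exI conjI allI impI)
    show "v i + 1 \<le> v (Suc i) - 1" using step[OF that] by simp
    show "v 0 < v i + 1" using mono[of 0 i] that by simp
    show "v (Suc i) - 1 < v k" using mono[of "Suc i" k] that by simp
    fix l assume "l \<le> k"
    then show "v l \<notin> {v i + 1..v (Suc i) - 1}"
      using mono[of l i] mono[of "Suc i" l] that by (cases "l \<le> i") auto
  qed simp
  have sub: "i = j" if "G i \<subseteq> G j" "i < k" "j < k" for i j
  proof (rule ccontr)
    assume "i \<noteq> j"
    have "v i + 1 \<in> G i" using step[OF that(2)] by (simp add: G_def)
    then have "v i + 1 \<in> G j" using that by blast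
    then show False
      using \<open>i \<noteq> j\<close> that mono[of "Suc i" j] mono[of "Suc j" i] step[OF that(2)]
      by (cases "i < j") (auto simp: G_def)
  qed
  have "X \<in> gaps (v ` {..k}) \<longleftrightarrow> X \<in> G ` {..<k}" for X
  proof
    assume X: "X \<in> gaps (v ` {..k})"
    then obtain i where i: "i < k" "X \<subseteq> G i" using inside unfolding gaps_def by blast
    then show "X \<in> G ` {..<k}" using X candG unfolding gaps_def by blast
  next
    assume "X \<in> G ` {..<k}"
    then obtain i where i: "i < k" "X = G i" by blast
    have "Y = X" if Y: "gap_candidate (v ` {..k}) Y" "X \<subseteq> Y" for Y
    proof -
      obtain j where j: "j < k" "Y \<subseteq> G j" using inside Y by blast
      then have "i = j" using sub[of i j] Y i by auto
      with Y i j show ?thesis by auto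
    qed
    then show "X \<in> gaps (v ` {..k})" using candG i by (auto simp: gaps_def)
  qed
  then show "gaps (v ` {..k}) = (\<lambda>i. {v i + 1..v (Suc i) - 1}) ` {..<k}" unfolding G_def by blast
  show "inj_on (\<lambda>i. {v i + 1..v (Suc i) - 1}) {..<k}"
    using sub unfolding G_def[symmetric] by (auto intro!: inj_onI)
qed

subsection \<open>Gadgets joined at a hub\<close>

datatype vert = Hub | U nat bool nat | W nat bool nat

instance vert :: countable by countable_datatype

text \<open>Edges are indexed by slots, so that a colouring becomes a function on slots. In \<open>U g s i\<close> and
  \<open>W g s j\<close> the index \<open>g\<close> is the gadget and \<open>s\<close> one of its two bipartite parts.\<close>

datatype slot = HubPort nat bool | Joint nat | Inner nat bool nat nat

fun edge_of :: "slot \<Rightarrow> vert set" where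
  "edge_of (HubPort g s) = {Hub, U g s 0}"
| "edge_of (Joint g) = {W g False 0, W g True 0}"
| "edge_of (Inner g s i j) = {U g s i, W g s j}"

lemma inj_edge_of: "inj edge_of"
proof (rule injI)
  fix x y assume "edge_of x = edge_of y"
  then show "x = y" by (cases x; cases y) (auto simp: doubleton_eq_iff)
qed

definition row_slot :: "nat \<Rightarrow> bool \<Rightarrow> nat \<Rightarrow> nat \<Rightarrow> slot" where
  "row_slot g s i j = (if i = 0 \<and> j = 0 then HubPort g s else Inner g s i j)"

text \<open>\<open>Joint g\<close> is independent of \<open>s\<close>: both parts of a gadget see
  the same edge here, which couples them.\<close>

definition col_slot :: "nat \<Rightarrow> bool \<Rightarrow> nat \<Rightarrow> nat \<Rightarrow> slot" where
  "col_slot g s i j = (if i = 0 \<and> j = 0 then Joint g else Inner g s i j)"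

locale gadget_graph =
  fixes K :: nat and p q :: "nat \<Rightarrow> bool \<Rightarrow> nat"
  assumes p2: "\<And>g s. g \<in> {1..K} \<Longrightarrow> 2 \<le> p g s" and q2: "\<And>g s. g \<in> {1..K} \<Longrightarrow> 2 \<le> q g s"
begin

definition slots :: "slot set" where
  "slots = (\<Union>g\<in>{1..K}. \<Union>s. \<Union>i\<in>{..<p g s}. \<Union>j\<in>{..<q g s}. {row_slot g s i j, col_slot g s i j})"

definition verts :: "vert set" where
  "verts = insert Hub (\<Union>g\<in>{1..K}. \<Union>s. U g s ` {..<p g s} \<union> W g s ` {..<q g s})"

definition valid :: "(slot \<Rightarrow> int) \<Rightarrow> bool" where
  "valid \<kappa> \<longleftrightarrow> consec_on (\<lambda>(g, s). \<kappa> (HubPort g s)) ({1..K} \<times> UNIV) \<and>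
    (\<forall>g\<in>{1..K}. \<forall>s. ported_grid (p g s) (q g s) (\<lambda>i j. \<kappa> (row_slot g s i j)) (\<lambda>i j. \<kappa> (col_slot g s i j)))"

lemma fin_graph_verts: "fin_graph verts (edge_of ` slots)"
proof -
  have "edge_of x \<subseteq> verts \<and> card (edge_of x) = 2" if "x \<in> slots" for x
  proof -
    from that obtain g s i j where x: "g \<in> {1..K}" "i < p g s" "j < q g s"
      "x = row_slot g s i j \<or> x = col_slot g s i j" by (auto simp: slots_def)
    have "0 < p g s'" "0 < q g s'" for s' using p2[OF x(1), of s'] q2[OF x(1), of s'] by auto
    moreover have "U g s' a \<in> verts" if "a < p g s'" for s' a using that x(1) unfolding verts_def by blast
    moreover have "W g s' a \<in> verts" if "a < q g s'" for s' a using that x(1) unfolding verts_def by blast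
    moreover have "Hub \<in> verts" by (simp add: verts_def)
    ultimately show ?thesis using x by (auto simp: row_slot_def col_slot_def split: if_splits)
  qed
  moreover have "finite verts" by (auto simp: verts_def)
  ultimately show ?thesis by (auto simp: fin_graph_def)
qed

lemma incident_Hub:
  "{e \<in> edge_of ` slots. Hub \<in> e} = (\<lambda>(g, s). edge_of (HubPort g s)) ` ({1..K} \<times> UNIV)"
  (is "?L = ?R")
proof
  show "?L \<subseteq> ?R"
  proof
    fix e assume "e \<in> ?L"
    then obtain x where x: "x \<in> slots" "e = edge_of x" "Hub \<in> edge_of x" by auto
    then obtain g s where "g \<in> {1..K}" "x = HubPort g s"
      by (auto simp: slots_def row_slot_def col_slot_def split: if_splits)
    then show "e \<in> ?R" using x by force
  qed
  have "HubPort g s \<in> slots" if "g \<in> {1..K}" for g s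
  proof -
    have "0 < p g s" "0 < q g s" using p2[OF that, of s] q2[OF that, of s] by auto
    moreover have "HubPort g s = row_slot g s 0 0" by (simp add: row_slot_def)
    ultimately show ?thesis using that unfolding slots_def by blast
  qed
  then show "?R \<subseteq> ?L" by (auto simp del: edge_of.simps) simp
qed

lemma incident_U:
  assumes "g \<in> {1..K}" "i < p g s"
  shows "{e \<in> edge_of ` slots. U g s i \<in> e} = (\<lambda>j. edge_of (row_slot g s i j)) ` {..<q g s}"
    (is "?L = ?R")
proof
  show "?L \<subseteq> ?R"
  proof
    fix e assume "e \<in> ?L"
    then obtain x where x: "x \<in> slots" "e = edge_of x" "U g s i \<in> edge_of x" by auto
    from x(1) obtain g' s' i' j' where x': "i' < p g' s'" "j' < q g' s'"
      "x = row_slot g' s' i' j' \<or> x = col_slot g' s' i' j'" by (auto simp: slots_def)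
    have "x = row_slot g s i j'" "g' = g" "s' = s"
      using x(3) x'(3) by (auto simp: row_slot_def col_slot_def split: if_splits)
    then show "e \<in> ?R" using x x' by auto
  qed
  have "row_slot g s i j \<in> slots" if "j < q g s" for j using assms that unfolding slots_def by blast
  moreover have "U g s i \<in> edge_of (row_slot g s i j)" for j by (simp add: row_slot_def)
  ultimately show "?R \<subseteq> ?L" by auto
qed

lemma incident_W:
  assumes "g \<in> {1..K}" "j < q g s"
  shows "{e \<in> edge_of ` slots. W g s j \<in> e} = (\<lambda>i. edge_of (col_slot g s i j)) ` {..<p g s}"
    (is "?L = ?R")
proof
  show "?L \<subseteq> ?R"
  proof
    fix e assume "e \<in> ?L"
    then obtain x where x: "x \<in> slots" "e = edge_of x" "W g s j \<in> edge_of x" by auto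
    from x(1) obtain g' s' i' j' where x': "i' < p g' s'" "j' < q g' s'"
      "x = row_slot g' s' i' j' \<or> x = col_slot g' s' i' j'" by (auto simp: slots_def)
    \<comment> \<open>The first alternative covers the shared edge \<open>Joint g\<close> when it is
      listed under the other part of the gadget.\<close>
    have "x = col_slot g s 0 j \<or> (x = col_slot g s i' j \<and> g' = g \<and> s' = s)"
      using x(3) x'(3) by (auto simp: row_slot_def col_slot_def split: if_splits)
    moreover have "0 < p g s" using p2[OF assms(1), of s] by simp
    ultimately show "e \<in> ?R" using x x' by auto
  qed
  have "col_slot g s i j \<in> slots" if "i < p g s" for i using assms that unfolding slots_def by blast
  moreover have "W g s j \<in> edge_of (col_slot g s i j)" for i by (cases s) (simp_all add: col_slot_def)
  ultimately show "?R \<subseteq> ?L" by auto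
qed

lemma interval_coloring_iff:
  "interval_coloring verts (edge_of ` slots) c \<longleftrightarrow> valid (\<lambda>x. c (edge_of x))"
proof -
  let ?P = "\<lambda>x. \<exists>X. consecutive X \<and> image_mset c (mset_set {e \<in> edge_of ` slots. x \<in> e}) = mset_set X"
  have e: "edge_of x = edge_of y \<longleftrightarrow> x = y" for x y using inj_edge_of by (simp add: inj_eq)
  have Hub: "?P Hub \<longleftrightarrow> consec_on (\<lambda>(g, s). c (edge_of (HubPort g s))) ({1..K} \<times> UNIV)"
    by (subst consecutive_mset_iff[OF _ _ incident_Hub])
      (auto simp: inj_on_def e case_prod_unfold simp del: edge_of.simps)
  have U: "?P (U g s i) \<longleftrightarrow> consec_on (\<lambda>j. c (edge_of (row_slot g s i j))) {..<q g s}"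
    if "g \<in> {1..K}" "i < p g s" for g s i
    by (subst consecutive_mset_iff[OF _ _ incident_U[OF that]])
      (auto simp: inj_on_def e row_slot_def simp del: edge_of.simps split: if_splits)
  have W: "?P (W g s j) \<longleftrightarrow> consec_on (\<lambda>i. c (edge_of (col_slot g s i j))) {..<p g s}"
    if "g \<in> {1..K}" "j < q g s" for g s j
    by (subst consecutive_mset_iff[OF _ _ incident_W[OF that]])
      (auto simp: inj_on_def e col_slot_def simp del: edge_of.simps split: if_splits)
  have grid: "ported_grid (p g s) (q g s) (\<lambda>i j. c (edge_of (row_slot g s i j))) (\<lambda>i j. c (edge_of (col_slot g s i j)))
      \<longleftrightarrow> (\<forall>i<p g s. ?P (U g s i)) \<and> (\<forall>j<q g s. ?P (W g s j))" if "g \<in> {1..K}" for g s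
    using U[OF that] W[OF that] p2[OF that] q2[OF that]
    by (auto simp: ported_grid_def row_slot_def col_slot_def simp del: edge_of.simps)
  have "interval_coloring verts (edge_of ` slots) c \<longleftrightarrow> ?P Hub \<and>
      (\<forall>g\<in>{1..K}. \<forall>s. (\<forall>i<p g s. ?P (U g s i)) \<and> (\<forall>j<q g s. ?P (W g s j)))"
    unfolding interval_coloring_def verts_def by blast
  then show ?thesis unfolding valid_def using grid Hub by (simp del: edge_of.simps)
qed

lemma spectrum_valid:
  "interval_spectrum verts (edge_of ` slots) = {int (card (\<kappa> ` slots)) |\<kappa>. valid \<kappa>}"
proof -
  \<comment> \<open>Since \<open>edge_of\<close> is injective, every function on slots arises from
    an edge colouring.\<close>
  have "\<exists>c. \<kappa> = (\<lambda>x. c (edge_of x))" for \<kappa> :: "slot \<Rightarrow> int"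
    using inj_edge_of by (intro exI[of _ "\<lambda>e. \<kappa> (inv edge_of e)"]) simp
  then show ?thesis
    unfolding interval_spectrum_def t_interval_colorable_def interval_coloring_iff image_image by metis
qed

end

subsection \<open>Rigidity and the spectrum\<close>

text \<open>The colours are i + j shifted by \<open>a\<close>, with column 0 counted as column
  \<open>q\<close>. The ports receive the extremes, so \<open>port_bound\<close> is
  attained.\<close>

lemma ported_grid_ascending:
  assumes "2 \<le> p" "2 \<le> q"
  shows "ported_grid p q
    (\<lambda>i j. a + (if i = 0 \<and> j = 0 then 0 else int i + int (if j = 0 then q else j)))
    (\<lambda>i j. a + (if i = 0 \<and> j = 0 then int p + int q else int i + int (if j = 0 then q else j)))"
    (is "ported_grid p q ?R ?C")
proof
  fix i assume i: "i < p"
  show "consec_on (?R i) {..<q}"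
  proof (cases "i = 0")
    case True
    then show ?thesis by (intro consec_on_shift[of _ _ a]) auto
  next
    case False
    then show ?thesis using assms by (intro consec_on_cyclic[of _ _ "a + int i"]) auto
  qed
next
  fix j assume j: "j < q"
  show "consec_on (\<lambda>i. ?C i j) {..<p}"
  proof (cases "j = 0")
    case True
    then show ?thesis using assms by (intro consec_on_cyclic[of _ _ "a + int q"]) auto
  next
    case False
    then show ?thesis by (intro consec_on_shift[of _ _ "a + int j"]) auto
  qed
qed (use assms in auto)

locale gadget_family =
  fixes K S :: nat
  assumes K_pos: "1 \<le> K" and S_large: "4 * K + 6 < S"
begin

text \<open>With n and n' for the values at \<open>False\<close> and \<open>True\<close>, 3 n - 2 n'
  = 2 g - 1. This becomes the distance between the two hub ports of gadget \<open>g\<close>.\<close>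

definition left_size :: "nat \<Rightarrow> bool \<Rightarrow> nat" where
  "left_size g s = (if s then 3 * (g * S) + 2 - g else 2 * (g * S) + 1)"

definition right_size :: "nat \<Rightarrow> bool \<Rightarrow> nat" where
  "right_size g s = (if s then left_size g True else 2 * left_size g False)"

lemma gS:
  assumes "g \<in> {1..K}"
  shows "S \<le> g * S" "g \<le> g * S"
  using assms S_large by (auto simp: Suc_le_eq)

lemma sizes:
  assumes "g \<in> {1..K}"
  shows "int (left_size g False) = 2 * int (g * S) + 1" "int (left_size g True) = 3 * int (g * S) + 2 - int g"
proof -
  define t where "t = g * S"
  have "g \<le> t" using gS(2)[OF assms] by (simp only: t_def)
  then show "int (left_size g False) = 2 * int (g * S) + 1" "int (left_size g True) = 3 * int (g * S) + 2 - int g"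
    unfolding left_size_def t_def[symmetric] by auto
qed

sublocale gadget_graph K left_size right_size
proof
  fix g s assume g: "g \<in> {1..K}"
  define t where "t = g * S"
  have "2 \<le> t" "g \<le> t" using gS[OF g] S_large unfolding t_def by linarith+
  then show left: "2 \<le> left_size g s" for s unfolding left_size_def t_def[symmetric] by auto
  show "2 \<le> right_size g s" using left[of True] left[of False] by (simp add: right_size_def)
qed

text \<open>The growth of a gadget's reach per unit of \<open>g\<close>: the joint of gadget
  \<open>g\<close> lies at distance \<open>T * g\<close> from the hub centre, up to a
  constant.\<close>

definition T :: int where "T = 6 * int S - 1"

lemma T_ge: "int K \<le> T"
  using S_large by (simp add: T_def)

lemma T_mult: "T * int g = 6 * int (g * S) - int g"
  by (simp add: T_def algebra_simps)

text \<open>The hub colours are centred at m - 1/2, and reflection in this point exchanges the two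
  directions; hence the offsets 3 and -4.\<close>

definition placed :: "(slot \<Rightarrow> int) \<Rightarrow> int \<Rightarrow> (nat \<Rightarrow> bool) \<Rightarrow> bool" where
  "placed \<kappa> m up \<longleftrightarrow> (\<forall>g\<in>{1..K}. if up g
     then \<kappa> (HubPort g False) = m - int g \<and> \<kappa> (HubPort g True) = m + int g - 1 \<and> \<kappa> (Joint g) = m + 3 + T * int g
     else \<kappa> (HubPort g False) = m + int g - 1 \<and> \<kappa> (HubPort g True) = m - int g \<and> \<kappa> (Joint g) = m - 4 - T * int g)"

section \<open>Joint displacements and positions at the hub\<close>

lemma valid_grid:
  assumes "valid \<kappa>" "g \<in> {1..K}"
  shows "ported_grid (left_size g s) (right_size g s)
    (\<lambda>i j. \<kappa> (row_slot g s i j)) (\<lambda>i j. \<kappa> (col_slot g s i j))"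
  using assms by (simp add: valid_def)

lemma valid_uminus:
  assumes "valid \<kappa>"
  shows "valid (\<lambda>x. - \<kappa> x)"
  using assms consec_on_uminus[of "\<lambda>(g, s). \<kappa> (HubPort g s)"]
  by (auto simp: valid_def case_prod_unfold intro: ported_grid.ported_grid_uminus)

lemma hub_ports_apart:
  assumes "valid \<kappa>" "g \<in> {1..K}"
  shows "\<kappa> (HubPort g False) \<noteq> \<kappa> (HubPort g True)"
    "\<bar>\<kappa> (HubPort g False) - \<kappa> (HubPort g True)\<bar> < 2 * int K"
proof -
  have *: "consec_on (\<lambda>(g, s). \<kappa> (HubPort g s)) ({1..K} \<times> UNIV)" using assms by (simp add: valid_def)
  then have inj: "inj_on (\<lambda>(g, s). \<kappa> (HubPort g s)) ({1..K} \<times> UNIV)" by (simp add: consec_on_def)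
  show "\<kappa> (HubPort g False) \<noteq> \<kappa> (HubPort g True)"
    using inj_on_eq_iff[OF inj, of "(g, False)" "(g, True)"] assms(2) by simp
  show "\<bar>\<kappa> (HubPort g False) - \<kappa> (HubPort g True)\<bar> < 2 * int K"
    using consec_on_less_card[OF *, of "(g, False)" "(g, True)"]
      consec_on_less_card[OF *, of "(g, True)" "(g, False)"] assms(2) by (simp add: card_cartesian_product)
qed

text \<open>\<open>port_difference\<close> makes the displacement a multiple of the left size, and
  \<open>port_bound\<close> limits it to the sum of both sizes, which is 3 or 2 times the left
  size.\<close>

lemma joint_displacement:
  assumes "valid \<kappa>" "g \<in> {1..K}"
  shows "\<exists>i\<in>{-3..3}. \<kappa> (Joint g) - \<kappa> (HubPort g False) = int (left_size g False) * i"
    and "\<exists>i\<in>{-2..2}. \<kappa> (Joint g) - \<kappa> (HubPort g True) = int (left_size g True) * i"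
proof -
  define n where "n = int (left_size g False)"
  define n' where "n' = int (left_size g True)"
  have pos: "0 < n" "0 < n'" using p2[OF assms(2), of False] p2[OF assms(2), of True] by (auto simp: n_def n'_def)
  interpret F: ported_grid "left_size g False" "right_size g False"
    "\<lambda>i j. \<kappa> (row_slot g False i j)" "\<lambda>i j. \<kappa> (col_slot g False i j)" by (rule valid_grid[OF assms])
  \<comment> \<open>The negated grid gives the bound in the opposite direction.\<close>
  interpret F': ported_grid "left_size g False" "right_size g False"
    "\<lambda>i j. - \<kappa> (row_slot g False i j)" "\<lambda>i j. - \<kappa> (col_slot g False i j)" by (rule F.ported_grid_uminus)
  interpret G: ported_grid "left_size g True" "right_size g True"
    "\<lambda>i j. \<kappa> (row_slot g True i j)" "\<lambda>i j. \<kappa> (col_slot g True i j)" by (rule valid_grid[OF assms])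
  interpret G': ported_grid "left_size g True" "right_size g True"
    "\<lambda>i j. - \<kappa> (row_slot g True i j)" "\<lambda>i j. - \<kappa> (col_slot g True i j)" by (rule G.ported_grid_uminus)
  have port: "row_slot g s 0 0 = HubPort g s" "col_slot g s 0 0 = Joint g" for s
    by (simp_all add: row_slot_def col_slot_def)
  have r: "int (right_size g False) = 2 * n" "int (right_size g True) = n'"
    by (simp_all add: n_def n'_def right_size_def)
  let ?e = "\<kappa> (HubPort g False)" and ?e' = "\<kappa> (HubPort g True)" and ?f = "\<kappa> (Joint g)"
  obtain A B where "2 * (?e - ?f) = 2 * (2 * n) * A - 2 * n * B + n * (2 * n) * (2 * n - n)"
    using F.port_difference unfolding port r n_def[symmetric] by blast
  then have eq: "?f - ?e = n * (B - 2 * A - n * n)" by (simp add: algebra_simps)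
  have "\<bar>?f - ?e\<bar> \<le> n * 3"
    using F.port_bound F'.port_bound unfolding port r n_def[symmetric] by linarith
  then have "n * \<bar>B - 2 * A - n * n\<bar> \<le> n * 3" using pos unfolding eq abs_mult by simp
  then have "B - 2 * A - n * n \<in> {-3..3}" using pos by auto
  with eq show "\<exists>i\<in>{-3..3}. ?f - ?e = int (left_size g False) * i" unfolding n_def by blast
  obtain A B where "2 * (?e' - ?f) = 2 * n' * A - 2 * n' * B + n' * n' * (n' - n')"
    using G.port_difference unfolding port r n'_def[symmetric] by blast
  then have eq: "?f - ?e' = n' * (B - A)" by (simp add: algebra_simps)
  have "\<bar>?f - ?e'\<bar> \<le> n' * 2"
    using G.port_bound G'.port_bound unfolding port r n'_def[symmetric] by linarith
  then have "n' * \<bar>B - A\<bar> \<le> n' * 2" using pos unfolding eq abs_mult by simp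
  then have "B - A \<in> {-2..2}" using pos by auto
  with eq show "\<exists>i\<in>{-2..2}. ?f - ?e' = int (left_size g True) * i" unfolding n'_def by blast
qed

text \<open>The two displacements differ by \<open>2 * i - 3 * i'\<close> times s = g S, up to a
  term small against s. As the hub allows less than 2 K, this coefficient vanishes, so (i, i') is
  (0,0) or \<plusminus>(3,2); (0,0) would give both hub edges the same colour.\<close>

lemma joint_extreme:
  assumes "valid \<kappa>" "g \<in> {1..K}"
  shows "(\<kappa> (Joint g) = \<kappa> (HubPort g False) + 3 * int (left_size g False) \<and>
      \<kappa> (Joint g) = \<kappa> (HubPort g True) + 2 * int (left_size g True)) \<or>
     (\<kappa> (Joint g) = \<kappa> (HubPort g False) - 3 * int (left_size g False) \<and>
      \<kappa> (Joint g) = \<kappa> (HubPort g True) - 2 * int (left_size g True))"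
proof -
  let ?e = "\<kappa> (HubPort g False)" and ?e' = "\<kappa> (HubPort g True)" and ?f = "\<kappa> (Joint g)"
  define s where "s = int (g * S)"
  have n: "int (left_size g False) = 2 * s + 1" "int (left_size g True) = 3 * s + 2 - int g"
    using sizes[OF assms(2)] by (simp_all add: s_def)
  obtain i where i: "i \<in> {-3..3}" "?f - ?e = (2 * s + 1) * i"
    using joint_displacement(1)[OF assms] unfolding n by blast
  obtain i' where i': "i' \<in> {-2..2}" "?f - ?e' = (3 * s + 2 - int g) * i'"
    using joint_displacement(2)[OF assms] unfolding n by blast
  have "4 * K + 6 < g * S" using gS(1)[OF assms(2)] S_large by linarith
  then have "int (4 * K + 6) < s" unfolding s_def by (simp only: of_nat_less_iff)
  then have s: "4 * int K + 6 < s" "int g \<le> int K" "1 \<le> int g" using assms(2) by auto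
  have i_cases: "i = -3 \<or> i = -2 \<or> i = -1 \<or> i = 0 \<or> i = 1 \<or> i = 2 \<or> i = 3" using i by auto
  have i'_cases: "i' = -2 \<or> i' = -1 \<or> i' = 0 \<or> i' = 1 \<or> i' = 2" using i' by auto
  have d: "?e \<noteq> ?e'" "?e - ?e' < 2 * int K" "?e' - ?e < 2 * int K" using hub_ports_apart[OF assms] by auto
  show ?thesis unfolding n
    using i_cases i'_cases i(2) i'(2) s d by (elim disjE; simp; linarith)
qed

text \<open>The two hub edges of gadget \<open>g\<close> have colours differing by \<open>2 g - 1\<close>. As the hub sees only
  \<open>2 K\<close> consecutive colours, these pairs must be nested, the largest gadget outermost.\<close>

lemma valid_placed:
  assumes "valid \<kappa>"
  shows "\<exists>m up. placed \<kappa> m up"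
proof -
  let ?e = "\<lambda>g. \<kappa> (HubPort g False)" and ?e' = "\<lambda>g. \<kappa> (HubPort g True)"
  define up where "up g \<longleftrightarrow> \<kappa> (Joint g) = ?e' g + 2 * int (left_size g True)" for g
  have hub: "consec_on (\<lambda>(g, s). \<kappa> (HubPort g s)) ({1..K} \<times> UNIV)" using assms by (simp add: valid_def)
  obtain a where a: "(\<lambda>(g, s). \<kappa> (HubPort g s)) ` ({1..K} \<times> UNIV) = {a..a + int K * 2 - 1}"
    using consec_on_image[OF hub] K_pos by (auto simp: card_cartesian_product)
  define m where "m = a + int K"
  have range: "\<kappa> (HubPort g s) \<in> {m - int K..m + int K - 1}" if "g \<in> {1..K}" for g s
  proof -
    have "\<kappa> (HubPort g s) \<in> (\<lambda>(g, s). \<kappa> (HubPort g s)) ` ({1..K} \<times> UNIV)" using that by force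
    then show ?thesis unfolding a m_def by simp
  qed
  have inj: "g = g'" if "\<kappa> (HubPort g s) = \<kappa> (HubPort g' s')" "g \<in> {1..K}" "g' \<in> {1..K}" for g g' s s'
  proof -
    have "inj_on (\<lambda>(g, s). \<kappa> (HubPort g s)) ({1..K} \<times> UNIV)" using hub by (simp add: consec_on_def)
    then have "(g, s) = (g', s')" by (rule inj_onD) (use that in auto)
    then show ?thesis by simp
  qed
  have diff: "?e' g - ?e g = (if up g then 2 * int g - 1 else 1 - 2 * int g)" if "g \<in> {1..K}" for g
    using joint_extreme[OF assms that] sizes[OF that] p2[OF that, of True] unfolding up_def by auto
  have nested: "?e g = (if up g then m - int g else m + int g - 1) \<and>
      ?e' g = (if up g then m + int g - 1 else m - int g)" if "g \<in> {1..K}" for g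
    using that
  proof (induction "K - g" arbitrary: g rule: less_induct)
    case less
    have inside: "\<kappa> (HubPort g s) \<in> {m - int g..m + int g - 1}" for s
    proof (rule ccontr)
      let ?x = "\<kappa> (HubPort g s)"
      assume out: "?x \<notin> {m - int g..m + int g - 1}"
      \<comment> \<open>The pairs m - h, m + h - 1 partition the hub colours, and \<open>h\<close>
        is the one containing \<open>?x\<close>. By induction that colour already belongs to gadget
        \<open>h\<close>.\<close>
      define h where "h = nat (if ?x < m then m - ?x else ?x - m + 1)"
      have h: "g < h" "h \<le> K" "?x = m - int h \<or> ?x = m + int h - 1"
        using out range[OF less.prems, of s] less.prems unfolding h_def by (auto split: if_splits)
      then have "?e h = ?x \<or> ?e' h = ?x" using less.hyps[of h] less.prems by (auto split: if_splits)
      then have "h = g" using inj[of h _ g s] h less.prems by auto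
      then show False using h by simp
    qed
    \<comment> \<open>In a window of 2 g colours, two colours at distance 2 g - 1 must be its
      ends.\<close>
    show ?case using inside[of True] inside[of False] diff[OF less.prems] by auto
  qed
  have "placed \<kappa> m up"
    unfolding placed_def
  proof
    fix g assume g: "g \<in> {1..K}"
    show "if up g
     then ?e g = m - int g \<and> ?e' g = m + int g - 1 \<and> \<kappa> (Joint g) = m + 3 + T * int g
     else ?e g = m + int g - 1 \<and> ?e' g = m - int g \<and> \<kappa> (Joint g) = m - 4 - T * int g"
      using nested[OF g] joint_extreme[OF assms g] sizes[OF g] unfolding T_mult
      by (auto simp: up_def)
  qed
  then show ?thesis by blast
qed

section \<open>Colours occurring in one gadget\<close>

definition gadget_slots :: "nat \<Rightarrow> slot set" where
  "gadget_slots g = (\<Union>s. \<Union>i\<in>{..<left_size g s}. \<Union>j\<in>{..<right_size g s}. {row_slot g s i j, col_slot g s i j})"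

text \<open>Both parts are tight, so their colours stay between hub port and joint. The
  \<open>False\<close> part starts at the lower hub port and has more right than left vertices, so
  it alone realises all these colours.\<close>

lemma gadget_colors_up:
  assumes "valid \<kappa>" "g \<in> {1..K}"
    and e: "\<kappa> (HubPort g False) = m - int g" and e': "\<kappa> (HubPort g True) = m + int g - 1"
    and f: "\<kappa> (Joint g) = m + 3 + T * int g"
  shows "\<kappa> ` gadget_slots g = {m - int g..m + 3 + T * int g}"
proof -
  have port: "row_slot g s 0 0 = HubPort g s" "col_slot g s 0 0 = Joint g" for s
    by (simp_all add: row_slot_def col_slot_def)
  have g1: "1 \<le> int g" using assms(2) by simp
  have tight: "\<kappa> (col_slot g s 0 0) = \<kappa> (row_slot g s 0 0) + int (left_size g s) + int (right_size g s)" for s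
    unfolding port using e e' f sizes[OF assms(2)] by (cases s) (simp_all add: T_mult right_size_def)
  have mem: "\<kappa> (row_slot g s i j) \<in> {m - int g..m + 3 + T * int g} \<and> \<kappa> (col_slot g s i j) \<in> {m - int g..m + 3 + T * int g}"
    if ij: "i < left_size g s" "j < right_size g s" for s i j
  proof -
    interpret ported_grid "left_size g s" "right_size g s"
      "\<lambda>i j. \<kappa> (row_slot g s i j)" "\<lambda>i j. \<kappa> (col_slot g s i j)" by (rule valid_grid[OF assms(1,2)])
    have r: "\<kappa> (row_slot g s i j) \<in> {\<kappa> (HubPort g s)..\<kappa> (Joint g)}"
      using tight_grid(1)[OF tight ij] unfolding port .
    moreover have "\<kappa> (col_slot g s i j) \<in> {\<kappa> (HubPort g s)..\<kappa> (Joint g)}"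
    proof (cases "(i, j) = (0, 0)")
      case True
      then show ?thesis using tight[of s] port by simp
    next
      case False
      then show ?thesis using r agree[OF ij] by simp
    qed
    moreover have "m - int g \<le> \<kappa> (HubPort g s)" using e e' g1 by (cases s) auto
    ultimately show ?thesis using f by auto
  qed
  have "{m - int g..m + 3 + T * int g} \<subseteq> \<kappa> ` gadget_slots g"
  proof
    interpret ported_grid "left_size g False" "right_size g False"
      "\<lambda>i j. \<kappa> (row_slot g False i j)" "\<lambda>i j. \<kappa> (col_slot g False i j)" by (rule valid_grid[OF assms(1,2)])
    fix x assume x: "x \<in> {m - int g..m + 3 + T * int g}"
    then have "\<exists>i<left_size g False. \<exists>j<right_size g False. x = \<kappa> (row_slot g False i j) \<or> x = \<kappa> (col_slot g False i j)"
      using tight_grid(2)[OF tight] unfolding port e f by (auto simp: right_size_def)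
    then show "x \<in> \<kappa> ` gadget_slots g" unfolding gadget_slots_def by blast
  qed
  moreover have "\<kappa> ` gadget_slots g \<subseteq> {m - int g..m + 3 + T * int g}"
    using mem unfolding gadget_slots_def by blast
  ultimately show ?thesis by blast
qed

lemma placed_uminus:
  assumes "placed \<kappa> m up"
  shows "placed (\<lambda>x. - \<kappa> x) (1 - m) (\<lambda>g. \<not> up g)"
  unfolding placed_def
proof
  fix g assume "g \<in> {1..K}"
  from bspec[OF assms[unfolded placed_def] this]
  show "if \<not> up g
     then - \<kappa> (HubPort g False) = 1 - m - int g \<and> - \<kappa> (HubPort g True) = 1 - m + int g - 1 \<and>
       - \<kappa> (Joint g) = 1 - m + 3 + T * int g
     else - \<kappa> (HubPort g False) = 1 - m + int g - 1 \<and> - \<kappa> (HubPort g True) = 1 - m - int g \<and>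
       - \<kappa> (Joint g) = 1 - m - 4 - T * int g"
    by (cases "up g") simp_all
qed

lemma gadget_colors:
  assumes "valid \<kappa>" "placed \<kappa> m up" "g \<in> {1..K}"
  shows "\<kappa> ` gadget_slots g = (if up g then {m - int g..m + 3 + T * int g} else {m - 4 - T * int g..m + int g - 1})"
proof (cases "up g")
  case True
  then show ?thesis using assms gadget_colors_up[of \<kappa> g m] by (auto simp: placed_def)
next
  case False
  have "(\<lambda>x. - \<kappa> x) ` gadget_slots g = {1 - m - int g..1 - m + 3 + T * int g}"
    using placed_uminus[OF assms(2)] assms(3) False
    by (intro gadget_colors_up[OF valid_uminus[OF assms(1)]]) (auto simp: placed_def)
  then have "uminus ` (\<lambda>x. - \<kappa> x) ` gadget_slots g = uminus ` {1 - m - int g..1 - m + 3 + T * int g}" by simp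
  then show ?thesis using False by (simp add: image_image algebra_simps)
qed

section \<open>Number of colours and the spectrum\<close>

definition color_count :: "nat \<Rightarrow> int" where
  "color_count i = (if i = 0 then T * int K + int K + 4 else T * int K + T * int i + 8)"

lemma color_count_step: "color_count i + T - int K < color_count (Suc i)"
  using K_pos by (auto simp: color_count_def algebra_simps)

text \<open>Here \<open>i\<close> is the largest gadget pointing against gadget \<open>K\<close>, or
  0 if there is none. The ranges of gadgets \<open>K\<close> and \<open>i\<close> overlap at the hub
  and contain those of all other gadgets, so the colours form one interval.\<close>

lemma card_colors:
  assumes "valid \<kappa>" "placed \<kappa> m up" "up K" "i < K"
    and down: "\<And>g. g \<in> {1..K} \<Longrightarrow> \<not> up g \<Longrightarrow> g \<le> i" "0 < i \<Longrightarrow> \<not> up i"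
  shows "int (card (\<kappa> ` slots)) = color_count i"
proof -
  define lo where "lo = (if i = 0 then m - int K else m - 4 - T * int i)"
  have T1: "int K \<le> T" "0 \<le> T" using T_ge by auto
  have T2: "T * int g \<le> T * int g'" if "g \<le> g'" for g g' using that T1 by (simp add: mult_left_mono)
  have "T * int 1 \<le> T * int K" using T2 K_pos by blast
  then have TK: "T \<le> T * int K" by simp
  have lo: "lo \<le> m - int K" using T2[of 1 i] T1 by (auto simp: lo_def)
  have "slots = (\<Union>g\<in>{1..K}. gadget_slots g)" unfolding slots_def gadget_slots_def ..
  then have col: "\<kappa> ` slots = (\<Union>g\<in>{1..K}. if up g then {m - int g..m + 3 + T * int g} else {m - 4 - T * int g..m + int g - 1})"
    using gadget_colors[OF assms(1,2)] by (simp add: image_UN)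
  have "\<kappa> ` slots = {lo..m + 3 + T * int K}"
  proof
    show "\<kappa> ` slots \<subseteq> {lo..m + 3 + T * int K}"
      unfolding col
    proof (intro UN_least)
      fix g assume g: "g \<in> {1..K}"
      have "m + 3 + T * int g \<le> m + 3 + T * int K" "lo \<le> m - int g" using g lo T2[of g K] by auto
      moreover have "lo \<le> m - 4 - T * int g" if "\<not> up g"
      proof -
        have "g \<le> i" using down(1)[OF g that] .
        then have "T * int g \<le> T * int i" "i \<noteq> 0" using T2 g by auto
        then show ?thesis by (simp add: lo_def)
      qed
      moreover have "m + int g - 1 \<le> m + 3 + T * int K"
      proof -
        have "int g \<le> int K" using g by simp
        then show ?thesis using T1 TK by linarith
      qed
      ultimately show "(if up g then {m - int g..m + 3 + T * int g} else {m - 4 - T * int g..m + int g - 1})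
          \<subseteq> {lo..m + 3 + T * int K}" by auto
    qed
    have sub: "(if up g then {m - int g..m + 3 + T * int g} else {m - 4 - T * int g..m + int g - 1}) \<subseteq> \<kappa> ` slots"
      if "g \<in> {1..K}" for g unfolding col using that by (rule UN_upper)
    have top: "{m - int K..m + 3 + T * int K} \<subseteq> \<kappa> ` slots" using sub[of K] assms(3) K_pos by simp
    show "{lo..m + 3 + T * int K} \<subseteq> \<kappa> ` slots"
    proof (cases "i = 0")
      case False
      then have "{lo..m + int i - 1} \<subseteq> \<kappa> ` slots" using sub[of i] down(2) \<open>i < K\<close> by (simp add: lo_def)
      moreover have "{lo..m + 3 + T * int K} \<subseteq> {lo..m + int i - 1} \<union> {m - int K..m + 3 + T * int K}" by auto
      ultimately show ?thesis using top by blast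
    qed (use top in \<open>simp add: lo_def\<close>)
  qed
  then show ?thesis using lo T2[of 0 K] by (auto simp: lo_def color_count_def)
qed

lemma valid_card:
  assumes "valid \<kappa>"
  shows "int (card (\<kappa> ` slots)) \<in> color_count ` {..<K}"
proof -
  have up: "int (card (\<kappa> ` slots)) \<in> color_count ` {..<K}"
    if "valid \<kappa>" "placed \<kappa> m up" "up K" for \<kappa> m up
  proof (cases "\<exists>g\<in>{1..K}. \<not> up g")
    case True
    define D where "D = {g \<in> {1..K}. \<not> up g}"
    have D: "finite D" "D \<noteq> {}" using True by (auto simp: D_def)
    have "Max D \<in> D" using D by simp
    then have "Max D < K" "\<not> up (Max D)" using that(3) by (auto simp: D_def le_less)
    moreover have "g \<le> Max D" if "g \<in> {1..K}" "\<not> up g" for g using that D by (simp add: D_def)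
    ultimately show ?thesis using card_colors[OF that, of "Max D"] by auto
  next
    case False
    then show ?thesis using card_colors[OF that, of 0] K_pos by (intro image_eqI[of _ _ 0]) auto
  qed
  obtain m u where u: "placed \<kappa> m u" using valid_placed[OF assms] by blast
  show ?thesis
  proof (cases "u K")
    case True
    then show ?thesis using up assms u by blast
  next
    case False
    \<comment> \<open>Negation keeps the number of colours and turns gadget \<open>K\<close>
      upwards.\<close>
    have "card ((\<lambda>x. - \<kappa> x) ` slots) = card (uminus ` \<kappa> ` slots)" by (simp add: image_image)
    also have "\<dots> = card (\<kappa> ` slots)" by (intro card_image) simp
    finally show ?thesis using up[OF valid_uminus[OF assms] placed_uminus[OF u]] False by simp
  qed
qed

lemma color_count_attained:
  assumes "i < K"
  shows "\<exists>\<kappa>. valid \<kappa> \<and> int (card (\<kappa> ` slots)) = color_count i"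
proof -
  \<comment> \<open>Only gadget \<open>i\<close> points downwards, and the hub parameter m is 0. For
    \<open>i = 0\<close> every gadget points upwards, as numbering starts at 1.\<close>
  define hub where "hub g s = (if s = (g \<noteq> i) then int g - 1 else - int g)" for g s
  define sg :: "nat \<Rightarrow> int" where "sg g = (if g = i then -1 else 1)" for g
  define \<kappa> where "\<kappa> x = (case x of HubPort g s \<Rightarrow> hub g s
      | Joint g \<Rightarrow> if g = i then - 4 - T * int g else 3 + T * int g
      | Inner g s a b \<Rightarrow> hub g s + sg g * (int a + int (if b = 0 then right_size g s else b)))" for x
  have joint: "\<kappa> (Joint g) = hub g s + sg g * (int (left_size g s) + int (right_size g s))" if "g \<in> {1..K}" for g s
    using sizes[OF that] by (cases s) (auto simp: \<kappa>_def hub_def sg_def T_mult right_size_def)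
  have "ported_grid (left_size g s) (right_size g s) (\<lambda>i j. \<kappa> (row_slot g s i j)) (\<lambda>i j. \<kappa> (col_slot g s i j))"
    if g: "g \<in> {1..K}" for g s
  proof -
    let ?R = "\<lambda>a x y. a + (if x = 0 \<and> y = 0 then 0 else int x + int (if y = 0 then right_size g s else y))"
    let ?C = "\<lambda>a x y. a + (if x = 0 \<and> y = 0 then int (left_size g s) + int (right_size g s)
        else int x + int (if y = 0 then right_size g s else y))"
    have *: "ported_grid (left_size g s) (right_size g s) (?R a) (?C a)" for a
      using ported_grid_ascending p2[OF g] q2[OF g] by blast
    show ?thesis
    proof (cases "g = i")
      case True
      have "(\<lambda>x y. \<kappa> (row_slot g s x y)) = (\<lambda>x y. - ?R (- hub g s) x y)"
        "(\<lambda>x y. \<kappa> (col_slot g s x y)) = (\<lambda>x y. - ?C (- hub g s) x y)"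
        using joint[OF g, of s] True
        by (auto simp: fun_eq_iff row_slot_def col_slot_def sg_def) (auto simp: \<kappa>_def sg_def)
      then show ?thesis using ported_grid.ported_grid_uminus[OF *[of "- hub g s"]] by simp
    next
      case False
      have "(\<lambda>x y. \<kappa> (row_slot g s x y)) = ?R (hub g s)" "(\<lambda>x y. \<kappa> (col_slot g s x y)) = ?C (hub g s)"
        using joint[OF g, of s] False
        by (auto simp: fun_eq_iff row_slot_def col_slot_def sg_def) (auto simp: \<kappa>_def sg_def)
      then show ?thesis using * by simp
    qed
  qed
  moreover have "consec_on (\<lambda>(g, s). \<kappa> (HubPort g s)) ({1..K} \<times> UNIV)"
  proof -
    have "(\<lambda>(g, s). \<kappa> (HubPort g s)) ` ({1..K} \<times> UNIV) = {- int K..int K - 1}" (is "?L = ?R")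
    proof
      show "?L \<subseteq> ?R" by (auto simp: \<kappa>_def hub_def)
      show "?R \<subseteq> ?L"
      proof
        fix x assume x: "x \<in> ?R"
        \<comment> \<open>The gadget whose pair \<open>- g\<close>, \<open>g - 1\<close> contains
          \<open>x\<close>. The sign of \<open>x\<close> selects the port, reversed for gadget
          \<open>i\<close>.\<close>
        define g where "g = nat (if x < 0 then - x else x + 1)"
        have g: "g \<in> {1..K}" using x by (auto simp: g_def)
        have "x = hub g ((g \<noteq> i) = (0 \<le> x))" by (auto simp: hub_def g_def)
        then have "x = (\<lambda>(g, s). \<kappa> (HubPort g s)) (g, (g \<noteq> i) = (0 \<le> x))" by (simp add: \<kappa>_def)
        then show "x \<in> ?L" using g by blast
      qed
    qed
    moreover have "inj_on (\<lambda>(g, s). \<kappa> (HubPort g s)) ({1..K} \<times> UNIV)"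
      by (auto simp: inj_on_def \<kappa>_def hub_def split: if_splits)
    ultimately show ?thesis by (auto simp: consec_on_def)
  qed
  ultimately have valid: "valid \<kappa>" by (simp add: valid_def)
  have "placed \<kappa> 0 (\<lambda>g. g \<noteq> i)" by (simp add: placed_def \<kappa>_def hub_def)
  from card_colors[OF valid this, of i] assms have "int (card (\<kappa> ` slots)) = color_count i" by simp
  then show ?thesis using valid by blast
qed

lemma spectrum: "interval_spectrum verts (edge_of ` slots) = color_count ` {..<K}"
proof -
  have "{int (card (\<kappa> ` slots)) |\<kappa>. valid \<kappa>} = color_count ` {..<K}"
  proof
    show "color_count ` {..<K} \<subseteq> {int (card (\<kappa> ` slots)) |\<kappa>. valid \<kappa>}"
      using color_count_attained by (auto simp del: of_nat_eq_iff) metis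
  qed (use valid_card in blast)
  then show ?thesis by (simp only: spectrum_valid)
qed

end

theorem theorem3:
  fixes k d :: nat
  shows "\<exists>(V :: nat set) E. fin_graph V E \<and>
           finite (gaps (interval_spectrum V E)) \<and>
           card (gaps (interval_spectrum V E)) = k \<and>
           (\<forall>X \<in> gaps (interval_spectrum V E). d \<le> card X)"
proof -
  \<comment> \<open>k + 1 gadgets give k + 1 colour counts and hence k gaps. The summand
    \<open>d\<close> in S makes successive counts differ by more than d + 1.\<close>
  interpret gadget_family "Suc k" "4 * Suc k + 7 + d" by unfold_locales auto
  let ?V = "to_nat ` verts" and ?E = "(`) to_nat ` edge_of ` slots"
  define c where "c = color_count"
  have "c i + T - int (Suc k) < c (Suc i)" for i using color_count_step by (simp only: c_def)
  moreover have "T = 24 * int (Suc k) + 41 + 6 * int d" unfolding T_def by simp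
  ultimately have step: "c i + int d + 1 < c (Suc i)" for i by (smt (verit) of_nat_0_le_iff)
  have "interval_spectrum ?V ?E = c ` {..k}"
    unfolding interval_spectrum_image[OF inj_to_nat] spectrum lessThan_Suc_atMost c_def ..
  moreover have "fin_graph ?V ?E" by (rule fin_graph_image[OF inj_to_nat fin_graph_verts])
  moreover have "gaps (c ` {..k}) = (\<lambda>i. {c i + 1..c (Suc i) - 1}) ` {..<k}"
    "inj_on (\<lambda>i. {c i + 1..c (Suc i) - 1}) {..<k}"
    by (rule gaps_sparse; smt (verit) step of_nat_0_le_iff)+
  moreover have "d \<le> card {c i + 1..c (Suc i) - 1}" for i
    using step[of i] by simp
  ultimately show ?thesis
    by (intro exI[of _ ?V] exI[of _ ?E]) (auto simp: card_image)
qed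

end
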